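(* Let $N\geq 2$, let $V$ be an $N$-dimensional complex vector space with a non-degenerate symmetric bilinear form $\eta_{ab}$, and let $K_{ab}=-K_{ba}$ be a bivector on $V$. Then the bivector alignment equations for $K_{ab}$ admit a zero in the complexified extended space of null directions; that is, there exists a non-zero null vector $k\in V$ whose null direction $[k]$ is aligned with $K_{ab}$.
   Context: A null frame is a basis $\ell=m_0$, $n=m_1$, $m_2,\dots,m_{N-1}$ of $V$ with $\eta(\ell,n)=1$, $\eta(m_i,m_i)=1$ for $i=2,\dots,N-1$, and all other products zero. Components with respect to a null frame are $K_{AB}=K(m_A,m_B)$. A null vector is a vector $k$ with $\eta(k,k)=0$; a null direction $[k]$ is the span of a non-zero null vector. A null direction $[k]$ is aligned with $K$ if $K_{0i}=0$ for all $2\le i\le N-1$ in a null frame with $\ell$ a scalar multiple of $k$ (this is independent of the choice of such a frame). Fixing a null frame, the bivector alignment equations are $p_{0j}(z)=0$, $j=2,\dots,N-1$, where (space-like indices raised and lowered trivially, repeated indices summed over $2,\dots,N-1$) $$p_{0j}(z)=K_{0j}+z^iK_{ij}-z_jK_{01}-\tfrac12 z^iz_i\,K_{1j}-z^iz_j\,K_{i1}.$$ A point $z\in\mathbb{C}^{N-2}$ corresponds to the null direction spanned by $\ell+z^im_i-\tfrac12 z^iz_i\,n$, and this direction is aligned with $K$ iff $z$ solves these equations. The extended space is the set of all null directions: it consists of these finite points together with the points at infinity, i.e. the remaining null directions, and a zero of the alignment equations means an aligned null direction in this extended space. *)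

theory Defs
  imports Complex_Main
begin

text \<open>
  Throughout, \<open>scale\<close> is the scalar multiplication of a complex vector space whose carrier is
  the whole type \<open>'v\<close>, and \<open>N\<close> is its dimension.
\<close>

definition bilinear_form ::
  "(complex \<Rightarrow> 'v::ab_group_add \<Rightarrow> 'v) \<Rightarrow> ('v \<Rightarrow> 'v \<Rightarrow> complex) \<Rightarrow> bool" where
  "bilinear_form scale B \<longleftrightarrow>
     (\<forall>x. Vector_Spaces.linear scale (*) (\<lambda>y. B x y)) \<and>
     (\<forall>y. Vector_Spaces.linear scale (*) (\<lambda>x. B x y))"

definition nondegenerate_symmetric_form ::
  "(complex \<Rightarrow> 'v::ab_group_add \<Rightarrow> 'v) \<Rightarrow> ('v \<Rightarrow> 'v \<Rightarrow> complex) \<Rightarrow> bool" where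
  "nondegenerate_symmetric_form scale \<eta> \<longleftrightarrow>
     bilinear_form scale \<eta> \<and>
     (\<forall>x y. \<eta> x y = \<eta> y x) \<and>
     (\<forall>x. (\<forall>y. \<eta> x y = 0) \<longrightarrow> x = 0)"

definition bivector ::
  "(complex \<Rightarrow> 'v::ab_group_add \<Rightarrow> 'v) \<Rightarrow> ('v \<Rightarrow> 'v \<Rightarrow> complex) \<Rightarrow> bool" where
  "bivector scale K \<longleftrightarrow> bilinear_form scale K \<and> (\<forall>x y. K x y = - K y x)"

text \<open>
  A frame is a function on \<open>nat\<close> of which only the values at indices below \<open>N\<close> matter;
  \<open>m 0\<close> and \<open>m 1\<close> are the vectors usually written \<open>l\<close> and \<open>n\<close>.
\<close>

definition null_frame ::
  "(complex \<Rightarrow> 'v::ab_group_add \<Rightarrow> 'v) \<Rightarrow> ('v \<Rightarrow> 'v \<Rightarrow> complex) \<Rightarrow> nat \<Rightarrow> (nat \<Rightarrow> 'v) \<Rightarrow> bool"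
  where
  "null_frame scale \<eta> N m \<longleftrightarrow>
     inj_on m {..<N} \<and>
     \<not> module.dependent scale (m ` {..<N}) \<and>
     module.span scale (m ` {..<N}) = UNIV \<and>
     (\<forall>i<N. \<forall>j<N. \<eta> (m i) (m j) =
        (if i = 0 \<and> j = 1 \<or> i = 1 \<and> j = 0 \<or> 2 \<le> i \<and> i = j then 1 else 0))"

definition null_vector :: "('v \<Rightarrow> 'v \<Rightarrow> complex) \<Rightarrow> 'v \<Rightarrow> bool" where
  "null_vector \<eta> k \<longleftrightarrow> \<eta> k k = 0"

definition direction ::
  "(complex \<Rightarrow> 'v::ab_group_add \<Rightarrow> 'v) \<Rightarrow> 'v \<Rightarrow> 'v set" where
  "direction scale k = module.span scale {k}"

definition extended_space ::
  "(complex \<Rightarrow> 'v::ab_group_add \<Rightarrow> 'v) \<Rightarrow> ('v \<Rightarrow> 'v \<Rightarrow> complex) \<Rightarrow> 'v set set" where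
  "extended_space scale \<eta> = {direction scale k | k. k \<noteq> 0 \<and> null_vector \<eta> k}"

text \<open>
  Alignment of a null direction does not depend on the frame chosen with \<open>m 0\<close> on the
  direction, hence the existential quantifier. As a member of a basis, \<open>m 0\<close> is non-zero, so it
  spans \<open>D\<close>.
\<close>

definition aligned ::
  "(complex \<Rightarrow> 'v::ab_group_add \<Rightarrow> 'v) \<Rightarrow> ('v \<Rightarrow> 'v \<Rightarrow> complex) \<Rightarrow> nat \<Rightarrow>
   ('v \<Rightarrow> 'v \<Rightarrow> complex) \<Rightarrow> 'v set \<Rightarrow> bool" where
  "aligned scale \<eta> N K D \<longleftrightarrow>
     D \<in> extended_space scale \<eta> \<and>
     (\<exists>m. null_frame scale \<eta> N m \<and> m 0 \<in> D \<and> (\<forall>i\<in>{2..<N}. K (m 0) (m i) = 0))"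

text \<open>
  A point of \<open>\<complex>\<^sup>N\<^sup>-\<^sup>2\<close> is given by the values \<open>z 2, \<dots>, z (N - 1)\<close>; other values of \<open>z\<close> are
  never used.
\<close>

definition finite_point ::
  "(complex \<Rightarrow> 'v::ab_group_add \<Rightarrow> 'v) \<Rightarrow> nat \<Rightarrow> (nat \<Rightarrow> 'v) \<Rightarrow> (nat \<Rightarrow> complex) \<Rightarrow> 'v"
  where
  "finite_point scale N m z =
     m 0 + (\<Sum>i\<in>{2..<N}. scale (z i) (m i)) - scale (1/2 * (\<Sum>i\<in>{2..<N}. z i * z i)) (m 1)"

definition alignment_poly ::
  "nat \<Rightarrow> ('v \<Rightarrow> 'v \<Rightarrow> complex) \<Rightarrow> (nat \<Rightarrow> 'v) \<Rightarrow> nat \<Rightarrow> (nat \<Rightarrow> complex) \<Rightarrow> complex" where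
  "alignment_poly N K m j z =
     K (m 0) (m j)
     + (\<Sum>i\<in>{2..<N}. z i * K (m i) (m j))
     - z j * K (m 0) (m 1)
     - 1/2 * (\<Sum>i\<in>{2..<N}. z i * z i) * K (m 1) (m j)
     - (\<Sum>i\<in>{2..<N}. z i * z j * K (m i) (m 1))"

text \<open>
  Zeros of the alignment equations in the extended space: at a finite point the equations
  themselves must hold; at a point at infinity, where there is no coordinate \<open>z\<close>, being a
  zero means being aligned.
\<close>

definition alignment_zero ::
  "(complex \<Rightarrow> 'v::ab_group_add \<Rightarrow> 'v) \<Rightarrow> ('v \<Rightarrow> 'v \<Rightarrow> complex) \<Rightarrow> nat \<Rightarrow>
   ('v \<Rightarrow> 'v \<Rightarrow> complex) \<Rightarrow> (nat \<Rightarrow> 'v) \<Rightarrow> 'v set \<Rightarrow> bool" where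
  "alignment_zero scale \<eta> N K m D \<longleftrightarrow>
     D \<in> extended_space scale \<eta> \<and>
     ((\<exists>z. D = direction scale (finite_point scale N m z) \<and>
           (\<forall>j\<in>{2..<N}. alignment_poly N K m j z = 0)) \<or>
      ((\<nexists>z. D = direction scale (finite_point scale N m z)) \<and> aligned scale \<eta> N K D))"

end

theory Submission
  imports Defs "HOL-Computational_Algebra.Fundamental_Theorem_Algebra"
begin

text \<open>
  Writing \<open>K x y = \<eta> x (A y)\<close> with an operator \<open>A\<close>, skew with respect to \<open>\<eta>\<close>, the direction of a
  null vector \<open>k\<close> is aligned as soon as \<open>k\<close> is an eigenvector of \<open>A\<close>. Take any eigenvector \<open>v\<close>.
  By skewness \<open>\<mu> * \<eta> v v = \<eta> v (A v) = 0\<close>, so if \<open>v\<close> is not null then \<open>A v = 0\<close>. In that case the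
  orthogonal complement of \<open>v\<close> is \<open>A\<close>-invariant and contains a second eigenvector \<open>u\<close>, and if \<open>u\<close> is
  not null either, then \<open>A u = 0\<close> and some combination \<open>u + c v\<close> is a null vector in the kernel
  of \<open>A\<close>.
\<close>

section \<open>Eigenvectors in invariant subspaces\<close>

locale alg_closed_vector_space = finite_dimensional_vector_space scale Basis
  for scale :: "'a::alg_closed_field \<Rightarrow> 'b::ab_group_add \<Rightarrow> 'b" and Basis
begin

text \<open>The vector \<open>p(f) v\<close>, built from the iterates of \<open>f\<close> on the
  single vector \<open>v\<close>, so that no ring of endomorphisms has to be set up.\<close>

definition poly_apply :: "('b \<Rightarrow> 'b) \<Rightarrow> 'a poly \<Rightarrow> 'b \<Rightarrow> 'b" where
  "poly_apply f p v = (\<Sum>i\<le>degree p. scale (coeff p i) ((f ^^ i) v))"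

lemma poly_apply_eq_sum:
  assumes "degree p \<le> n"
  shows "poly_apply f p v = (\<Sum>i\<le>n. scale (coeff p i) ((f ^^ i) v))"
  unfolding poly_apply_def
  by (rule sum.mono_neutral_left) (use assms in \<open>auto simp: coeff_eq_0\<close>)

text \<open>Multiplying \<open>q\<close> by \<open>X - c\<close> composes with \<open>f - c\<close>:
  the factor \<open>X\<close> shifts the coefficients by one, which costs one more application of
  \<open>f\<close>.\<close>

lemma poly_apply_linear_factor:
  assumes "Vector_Spaces.linear scale scale f"
  shows "poly_apply f ([:-c, 1:] * q) v = f (poly_apply f q v) - scale c (poly_apply f q v)"
proof -
  interpret f: Vector_Spaces.linear scale scale f by fact
  define n where "n = degree q"
  have "degree ([:-c, 1:] * q) \<le> Suc n"
    using degree_mult_le[of "[:-c, 1:]" q] by (simp add: n_def)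
  then have "poly_apply f ([:-c, 1:] * q) v =
      (\<Sum>i\<le>Suc n. scale (coeff ([:-c, 1:] * q) i) ((f ^^ i) v))"
    by (rule poly_apply_eq_sum)
  also have "\<dots> = (\<Sum>i\<le>Suc n. scale (coeff (pCons 0 q) i) ((f ^^ i) v))
      - (\<Sum>i\<le>Suc n. scale c (scale (coeff q i) ((f ^^ i) v)))"
    unfolding sum_subtractf[symmetric] by (intro sum.cong refl) (simp add: algebra_simps)
  also have "(\<Sum>i\<le>Suc n. scale (coeff (pCons 0 q) i) ((f ^^ i) v)) = f (poly_apply f q v)"
    \<comment> \<open>The zeroth coefficient of \<open>pCons 0 q\<close> vanishes; in every other
      term linearity pulls one \<open>f\<close> out of the sum.\<close>
    by (simp only: sum.atMost_Suc_shift)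
       (simp add: poly_apply_def n_def f.sum f.scale)
  also have "(\<Sum>i\<le>Suc n. scale c (scale (coeff q i) ((f ^^ i) v))) = scale c (poly_apply f q v)"
    unfolding scale_sum_right[symmetric]
    by (subst poly_apply_eq_sum[of q "Suc n"]) (simp_all add: n_def)
  finally show ?thesis .
qed

lemma poly_apply_in_subspace:
  assumes "subspace U" "f ` U \<subseteq> U" "v \<in> U"
  shows "poly_apply f p v \<in> U"
proof -
  have "(f ^^ i) v \<in> U" for i
    using assms by (induction i) auto
  then show ?thesis
    unfolding poly_apply_def using assms(1) by (intro subspace_sum subspace_scale)
qed

text \<open>The \<open>dimension + 1\<close> vectors \<open>v, f v, f (f v), ...\<close> cannot be
  independent, and the coefficients of a linear relation are those of the polynomial.\<close>

lemma ex_annihilating_poly: "\<exists>p. p \<noteq> 0 \<and> poly_apply f p v = 0"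
\<comment> \<open>Dependence is a property of sets and does not see repetitions. If two iterates
  with exponents \<open>i\<close> and \<open>j\<close> coincide, \<open>X^i - X^j\<close>
  annihilates \<open>v\<close> directly.\<close>
proof (cases "inj_on (\<lambda>i. (f ^^ i) v) {..dimension}")
  case True
  let ?S = "(\<lambda>i. (f ^^ i) v) ` {..dimension}"
  have "card ?S = Suc dimension"
    using card_image[OF True] by simp
  then have "dependent ?S"
    using dim_subset_UNIV[of ?S] by (intro dependent_biggerset_general) simp
  then obtain u x where u: "(\<Sum>w\<in>?S. scale (u w) w) = 0" "x \<in> ?S" "u x \<noteq> 0"
    by (auto simp: dependent_finite)
  define p where "p = (\<Sum>i\<le>dimension. monom (u ((f ^^ i) v)) i)"
  have coeff: "coeff p i = (if i \<le> dimension then u ((f ^^ i) v) else 0)" for i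
    by (auto simp: p_def coeff_sum)
  have "degree p \<le> dimension"
    by (rule degree_le) (simp add: coeff)
  then have "poly_apply f p v = (\<Sum>i\<le>dimension. scale (u ((f ^^ i) v)) ((f ^^ i) v))"
    by (subst poly_apply_eq_sum) (auto simp: coeff)
  also have "\<dots> = 0"
    using u(1) by (simp add: sum.reindex[OF True])
  finally have "poly_apply f p v = 0" .
  moreover obtain i where "i \<le> dimension" "x = (f ^^ i) v"
    using u(2) by auto
  then have "coeff p i \<noteq> 0" using u(3) by (simp add: coeff)
  then have "p \<noteq> 0" by auto
  ultimately show ?thesis by blast
next
  case False
  then obtain i j where ij: "i \<noteq> j" "(f ^^ i) v = (f ^^ j) v"
    by (auto simp: inj_on_def)
  let ?p = "monom 1 i - monom 1 j :: 'a poly"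
  have "degree ?p \<le> max i j"
    by (intro degree_diff_le) (auto intro: order_trans[OF degree_monom_le])
  then have "poly_apply f ?p v =
      (\<Sum>k\<le>max i j. scale (if k = i then 1 else 0) ((f ^^ k) v))
      - (\<Sum>k\<le>max i j. scale (if k = j then 1 else 0) ((f ^^ k) v))"
    unfolding sum_subtractf[symmetric]
    by (subst poly_apply_eq_sum) (auto intro!: sum.cong simp: algebra_simps)
  also have "\<dots> = 0"
    using ij(2) by (simp add: if_distrib[of "\<lambda>c. scale c _"] cong: if_cong)
  finally have "poly_apply f ?p v = 0" .
  moreover have "?p \<noteq> 0"
    using ij(1) by (simp add: monom_eq_iff')
  ultimately show ?thesis by blast
qed

text \<open>Split off a root: \<open>p = (X - c) q\<close>. Either \<open>q(f) v\<close> is non-zero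
  and an eigenvector for \<open>c\<close>, or \<open>q\<close> annihilates \<open>v\<close> and has
  smaller degree. Invariance of \<open>U\<close> keeps \<open>q(f) v\<close> in
  \<open>U\<close>.\<close>

lemma ex_eigenvector_if_annihilated:
  assumes f: "Vector_Spaces.linear scale scale f"
    and U: "subspace U" "f ` U \<subseteq> U"
    and "v \<in> U" "v \<noteq> 0" "p \<noteq> 0" "poly_apply f p v = 0"
  shows "\<exists>c w. w \<in> U \<and> w \<noteq> 0 \<and> f w = scale c w"
  using assms(4-)
proof (induction "degree p" arbitrary: p rule: less_induct)
  case less
  have "degree p > 0"
  proof (rule ccontr)
    assume "\<not> degree p > 0"
    then obtain a where "p = [:a:]" using degree_eq_zeroE by blast
    then show False using less.prems by (simp add: poly_apply_def)
  qed
  then obtain c where "poly p c = 0"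
    using alg_closed_imp_poly_has_root by blast
  then obtain q where p: "p = [:-c, 1:] * q"
    by (metis dvdE poly_eq_0_iff_dvd)
  with less.prems have "q \<noteq> 0" by auto
  then have deg: "degree q < degree p"
    unfolding p by (subst degree_mult_eq) auto
  let ?w = "poly_apply f q v"
  have "f ?w = scale c ?w"
    using less.prems poly_apply_linear_factor[OF f, of c q v] by (simp add: p)
  moreover have "?w \<in> U"
    by (rule poly_apply_in_subspace) (use U less.prems in auto)
  ultimately show ?case
    using less.hyps[OF deg] less.prems \<open>q \<noteq> 0\<close> by blast
qed

lemma ex_eigenvector:
  assumes "Vector_Spaces.linear scale scale f" "subspace U" "f ` U \<subseteq> U" "v \<in> U" "v \<noteq> 0"
  shows "\<exists>c w. w \<in> U \<and> w \<noteq> 0 \<and> f w = scale c w"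
proof -
  obtain p where "p \<noteq> 0" "poly_apply f p v = 0"
    using ex_annihilating_poly by blast
  then show ?thesis
    using ex_eigenvector_if_annihilated[OF assms] by blast
qed

end

section \<open>Orthonormal bases and null frames\<close>

locale complex_quadratic_space = alg_closed_vector_space scale Basis
  for scale :: "complex \<Rightarrow> 'v::ab_group_add \<Rightarrow> 'v" and Basis +
  fixes \<eta> :: "'v \<Rightarrow> 'v \<Rightarrow> complex"
  assumes form: "nondegenerate_symmetric_form scale \<eta>"
begin

section \<open>Calculation rules for the bilinear form\<close>

lemma linear_form_right: "Vector_Spaces.linear scale (*) (\<eta> x)"
  using form by (auto simp: nondegenerate_symmetric_form_def bilinear_form_def)

lemma form_commute: "\<eta> x y = \<eta> y x"
  using form by (auto simp: nondegenerate_symmetric_form_def)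

lemma nondegenerate: "(\<And>y. \<eta> x y = 0) \<Longrightarrow> x = 0"
  using form by (auto simp: nondegenerate_symmetric_form_def)

lemma form_add_right: "\<eta> x (y + z) = \<eta> x y + \<eta> x z"
  and form_scale_right: "\<eta> x (scale c y) = c * \<eta> x y"
  using linear_form_right[of x] by (auto simp: Vector_Spaces.linear_iff)

lemma form_add_left: "\<eta> (y + z) x = \<eta> y x + \<eta> z x"
  and form_scale_left: "\<eta> (scale c y) x = c * \<eta> y x"
  by (simp_all add: form_commute[of _ x] form_add_right form_scale_right)

lemma form_zero_right: "\<eta> x 0 = 0"
  using form_scale_right[of x 0 0] by simp

lemma form_zero_left: "\<eta> 0 x = 0"
  using form_scale_left[of 0 0 x] by simp

lemma form_diff_right: "\<eta> x (y - z) = \<eta> x y - \<eta> x z"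
  using form_add_right[of x "y - z" z] by simp

lemma form_diff_left: "\<eta> (y - z) x = \<eta> y x - \<eta> z x"
  by (simp add: form_commute[of _ x] form_diff_right)

lemma form_sum_right: "\<eta> x (\<Sum>i\<in>I. g i) = (\<Sum>i\<in>I. \<eta> x (g i))"
  by (induction I rule: infinite_finite_induct) (auto simp: form_zero_right form_add_right)

lemma form_sum_left: "\<eta> (\<Sum>i\<in>I. g i) x = (\<Sum>i\<in>I. \<eta> (g i) x)"
  by (simp add: form_commute[of _ x] form_sum_right)

lemmas form_simps = form_add_right form_scale_right form_add_left form_scale_left
  form_zero_right form_zero_left form_diff_right form_diff_left form_sum_right form_sum_left

lemma subspace_orthogonal: "subspace {x. \<eta> a x = 0}"
  by (auto simp: subspace_def form_simps)

text \<open>The functional \<open>\<eta> (d a)\<close> kills the span of all other elements of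
  \<open>S\<close> but not \<open>a\<close> itself.\<close>

lemma independent_if_dual:
  assumes "\<And>a. a \<in> S \<Longrightarrow> \<eta> (d a) a \<noteq> 0"
    and "\<And>a b. a \<in> S \<Longrightarrow> b \<in> S \<Longrightarrow> b \<noteq> a \<Longrightarrow> \<eta> (d a) b = 0"
  shows "independent S"
proof
  assume "dependent S"
  then obtain a where a: "a \<in> S" "a \<in> span (S - {a})"
    by (auto simp: dependent_def)
  have "span (S - {a}) \<subseteq> {x. \<eta> (d a) x = 0}"
    by (rule span_minimal) (use assms(2) a in \<open>auto simp: subspace_orthogonal\<close>)
  then show False
    using a assms(1) by blast
qed

section \<open>Orthonormal sets and their extension to bases\<close>

definition orthonormal :: "'v set \<Rightarrow> bool" where
  "orthonormal B \<longleftrightarrow> (\<forall>a\<in>B. \<forall>b\<in>B. \<eta> a b = (if a = b then 1 else 0))"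

lemma orthonormalD: "orthonormal B \<Longrightarrow> a \<in> B \<Longrightarrow> b \<in> B \<Longrightarrow> \<eta> a b = (if a = b then 1 else 0)"
  by (simp add: orthonormal_def)

lemma independent_orthonormal: "orthonormal B \<Longrightarrow> independent B"
  by (rule independent_if_dual[where d = id]) (auto simp: orthonormalD)

lemma finite_orthonormal: "orthonormal B \<Longrightarrow> finite B"
  by (intro finiteI_independent independent_orthonormal)

text \<open>Choose an orthonormal subset of \<open>W\<close> of maximal size. What is left of
  \<open>W\<close> orthogonally to it is totally isotropic, hence orthogonal to all of
  \<open>W\<close>, hence zero.\<close>

lemma ex_orthonormal_basis:
  assumes W: "subspace W"
    and nondeg: "\<And>x. x \<in> W \<Longrightarrow> (\<And>y. y \<in> W \<Longrightarrow> \<eta> x y = 0) \<Longrightarrow> x = 0"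
  shows "\<exists>B. orthonormal B \<and> B \<subseteq> W \<and> span B = W"
proof -
  have "\<exists>B. (orthonormal B \<and> B \<subseteq> W) \<and> (\<forall>B'. orthonormal B' \<and> B' \<subseteq> W \<longrightarrow> card B' \<le> card B)"
  proof (rule ex_has_greatest_nat[where k = "{}" and b = "Suc dimension"])
    show "orthonormal {} \<and> {} \<subseteq> W" by (simp add: orthonormal_def)
    show "\<forall>B. orthonormal B \<and> B \<subseteq> W \<longrightarrow> card B < Suc dimension"
      using independent_card_le_dim[OF subset_UNIV independent_orthonormal]
      by (simp add: dimension_def less_Suc_eq_le)
  qed
  then obtain B where B: "orthonormal B" "B \<subseteq> W"
    and max: "\<And>B'. orthonormal B' \<Longrightarrow> B' \<subseteq> W \<Longrightarrow> card B' \<le> card B"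
    by blast
  note fin = finite_orthonormal[OF B(1)]
  \<comment> \<open>A non-null vector orthogonal to \<open>B\<close> could be normalised, as every
    complex number has a square root, and would enlarge \<open>B\<close>.\<close>
  have null: "\<eta> x x = 0" if x: "x \<in> W" "\<And>b. b \<in> B \<Longrightarrow> \<eta> x b = 0" for x
  proof (rule ccontr)
    assume nz: "\<eta> x x \<noteq> 0"
    define e where "e = scale (1 / csqrt (\<eta> x x)) x"
    have sq: "csqrt (\<eta> x x) * csqrt (\<eta> x x) = \<eta> x x"
      by (metis power2_csqrt power2_eq_square)
    have "\<eta> e e = \<eta> x x / (csqrt (\<eta> x x) * csqrt (\<eta> x x))"
      by (simp only: e_def form_simps) simp
    then have e1: "\<eta> e e = 1"
      using nz unfolding sq by simp
    have e2: "\<eta> e b = 0" if "b \<in> B" for b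
      using x(2)[OF that] by (simp add: e_def form_simps)
    then have e: "\<eta> e e = 1" "\<And>b. b \<in> B \<Longrightarrow> \<eta> e b = 0" "\<And>b. b \<in> B \<Longrightarrow> \<eta> b e = 0"
      using e1 form_commute by metis+
    have "e \<notin> B" using e by fastforce
    moreover have "orthonormal (insert e B)"
      using e B(1) unfolding orthonormal_def by auto
    moreover have "insert e B \<subseteq> W"
      using B(2) x(1) W by (auto simp: e_def subspace_scale)
    ultimately show False
      using max[of "insert e B"] fin by simp
  qed
  \<comment> \<open>Polarisation: \<open>\<eta> (x + y) (x + y)\<close> reduces to
    \<open>2 * \<eta> x y\<close> when \<open>x\<close> and \<open>y\<close> are null.\<close>
  have orth: "\<eta> x y = 0"
    if "x \<in> W" "\<And>b. b \<in> B \<Longrightarrow> \<eta> x b = 0" "y \<in> W" "\<And>b. b \<in> B \<Longrightarrow> \<eta> y b = 0" for x y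
    using null[of "x + y"] null[of x] null[of y] that subspace_add[OF W]
    by (simp add: form_simps form_commute[of y x])
  define proj where "proj x = x - (\<Sum>b\<in>B. scale (\<eta> x b) b)" for x
  have proj: "proj x \<in> W" "\<And>b. b \<in> B \<Longrightarrow> \<eta> (proj x) b = 0" if "x \<in> W" for x
  proof -
    show "proj x \<in> W"
      unfolding proj_def using that B(2)
      by (intro subspace_diff[OF W] subspace_sum[OF W] subspace_scale[OF W]) auto
    show "\<eta> (proj x) b = 0" if "b \<in> B" for b
    proof -
      have "(\<Sum>c\<in>B. \<eta> x c * \<eta> c b) = (\<Sum>c\<in>B. if c = b then \<eta> x c else 0)"
        using that orthonormalD[OF B(1)] by (intro sum.cong) auto
      also have "\<dots> = \<eta> x b" using that fin by simp
      finally show ?thesis by (simp add: proj_def form_simps)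
    qed
  qed
  have "W \<subseteq> span B"
  proof
    fix x assume x: "x \<in> W"
    have "proj x = 0"
    proof (rule nondeg)
      show "proj x \<in> W" using proj x by blast
      fix y assume y: "y \<in> W"
      have "y = proj y + (\<Sum>b\<in>B. scale (\<eta> y b) b)" by (simp add: proj_def)
      moreover have "\<eta> (proj x) (proj y + (\<Sum>b\<in>B. scale (\<eta> y b) b)) =
          \<eta> (proj x) (proj y) + (\<Sum>b\<in>B. \<eta> y b * \<eta> (proj x) b)"
        by (simp only: form_simps)
      ultimately have "\<eta> (proj x) y = \<eta> (proj x) (proj y) + (\<Sum>b\<in>B. \<eta> y b * \<eta> (proj x) b)"
        by simp
      also have "\<dots> = 0"
        using proj x y orth by simp
      finally show "\<eta> (proj x) y = 0" .
    qed
    then have "x = (\<Sum>b\<in>B. scale (\<eta> x b) b)" by (simp add: proj_def)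
    also have "\<dots> \<in> span B" by (intro span_sum span_scale span_base)
    finally show "x \<in> span B" .
  qed
  then show ?thesis
    using B span_minimal[OF B(2) W] by blast
qed

text \<open>Complete \<open>k\<close> to a hyperbolic pair \<open>k\<close>, \<open>n\<close>; the
  orthogonal complement of the pair is again non-degenerate and supplies the space-like
  vectors.\<close>

lemma ex_null_frame:
  assumes k: "k \<noteq> 0" "\<eta> k k = 0" and "dim UNIV = N"
  shows "\<exists>m. null_frame scale \<eta> N m \<and> m 0 = k"
proof -
  obtain y where y: "\<eta> k y \<noteq> 0" using k(1) nondegenerate by blast
  define y' where "y' = scale (1 / \<eta> k y) y"
  \<comment> \<open>Since \<open>k\<close> is null, subtracting a multiple of \<open>k\<close>
    leaves the product with \<open>k\<close> at 1; half of \<open>\<eta> y' y'\<close> is the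
    multiple that makes \<open>n\<close> null.\<close>
  define n where "n = y' - scale (\<eta> y' y' / 2) k"
  have "\<eta> k y' = 1" using y by (simp add: y'_def form_simps)
  then have kn: "\<eta> k n = 1" "\<eta> n k = 1" "\<eta> n n = 0"
    using k(2) by (simp_all add: n_def form_simps form_commute[of y' k])
  define W where "W = {x. \<eta> k x = 0} \<inter> {x. \<eta> n x = 0}"
  have W: "subspace W"
    unfolding W_def by (intro subspace_inter subspace_orthogonal)
  \<comment> \<open>The coefficients are crossed because \<open>k\<close> and \<open>n\<close> are
    dual to each other, not to themselves.\<close>
  have decomp: "x - scale (\<eta> n x) k - scale (\<eta> k x) n \<in> W" for x
    using kn k(2) by (simp add: W_def form_simps)
  have "\<exists>B. orthonormal B \<and> B \<subseteq> W \<and> span B = W"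
  proof (rule ex_orthonormal_basis[OF W])
    fix x assume x: "x \<in> W" "\<And>y. y \<in> W \<Longrightarrow> \<eta> x y = 0"
    have "\<eta> x k = 0" "\<eta> x n = 0" using x(1) by (auto simp: W_def form_commute[of x])
    then have "\<eta> x y = 0" for y
      using x(2)[OF decomp[of y]] by (simp add: form_simps)
    then show "x = 0" by (rule nondegenerate)
  qed
  then obtain B where B: "orthonormal B" "B \<subseteq> W" "span B = W" by blast
  have Bk: "\<eta> k b = 0" "\<eta> n b = 0" "\<eta> b k = 0" "\<eta> b n = 0" if "b \<in> B" for b
    using that B(2) by (auto simp: W_def form_commute[of b])
  have fresh: "k \<notin> B" "n \<notin> B" "k \<noteq> n"
    using Bk kn k(2) by fastforce+
  let ?S = "insert k (insert n B)"
  have ind: "independent ?S"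
    \<comment> \<open>The dual family swaps \<open>k\<close> and \<open>n\<close> and fixes each
      element of \<open>B\<close>.\<close>
    by (rule independent_if_dual[where d = "\<lambda>x. if x = k then n else if x = n then k else x"])
       (use kn k(2) Bk fresh orthonormalD[OF B(1)] in \<open>auto split: if_splits\<close>)
  have span: "span ?S = UNIV"
  proof -
    have "x \<in> span ?S" for x
    proof -
      have "x - scale (\<eta> n x) k - scale (\<eta> k x) n \<in> span ?S"
        using decomp[of x] B(3) span_mono[of B ?S] by blast
      moreover have "scale (\<eta> n x) k + scale (\<eta> k x) n \<in> span ?S"
        by (intro span_add span_scale span_base) auto
      ultimately have "(x - scale (\<eta> n x) k - scale (\<eta> k x) n)
          + (scale (\<eta> n x) k + scale (\<eta> k x) n) \<in> span ?S"
        by (rule span_add)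
      then show ?thesis by (simp add: algebra_simps)
    qed
    then show ?thesis by blast
  qed
  have fin: "finite B" by (rule finite_orthonormal[OF B(1)])
  have "card ?S = N"
    using basis_card_eq_dim[of ?S UNIV] ind span assms(3) by simp
  then have card: "N = card B + 2" using fin fresh by simp
  obtain g where g: "bij_betw g {0..<card B} B"
    using ex_bij_betw_nat_finite[OF fin] by blast
  define m where "m i = (if i = 0 then k else if i = 1 then n else g (i - 2))" for i
  have gB: "g (i - 2) \<in> B" if "2 \<le> i" "i < N" for i
    using g that card by (auto simp: bij_betw_def)
  have g_eq: "g (i - 2) = g (j - 2) \<longleftrightarrow> i = j" if "2 \<le> i" "i < N" "2 \<le> j" "j < N" for i j
    using g that card by (auto simp: bij_betw_def inj_on_eq_iff)
  have split: "{..<N} = insert 0 (insert 1 {2..<N})" using card by auto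
  have "m ` {2..<N} = B"
  proof
    show "m ` {2..<N} \<subseteq> B" using gB by (auto simp: m_def)
    show "B \<subseteq> m ` {2..<N}"
    proof
      fix b assume "b \<in> B"
      then obtain i where "i < card B" "b = g i"
        using bij_betw_imp_surj_on[OF g] by (metis atLeastLessThan_iff imageE)
      then have "b = m (i + 2)" "i + 2 \<in> {2..<N}" using card by (auto simp: m_def)
      then show "b \<in> m ` {2..<N}" by blast
    qed
  qed
  then have image: "m ` {..<N} = ?S" unfolding split image_insert by (simp add: m_def[of 0] m_def[of "Suc 0"])
  \<comment> \<open>The image of the \<open>N\<close> indices has \<open>N\<close> elements.\<close>
  have "inj_on m {..<N}"
    by (rule eq_card_imp_inj_on) (simp_all add: image \<open>card ?S = N\<close>)
  moreover have "\<eta> (m i) (m j) =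
      (if i = 0 \<and> j = 1 \<or> i = 1 \<and> j = 0 \<or> 2 \<le> i \<and> i = j then 1 else 0)"
    if "i < N" "j < N" for i j
  proof -
    consider "i = 0" | "i = 1" | "2 \<le> i" by linarith
    moreover consider "j = 0" | "j = 1" | "2 \<le> j" by linarith
    ultimately show ?thesis
      using k(2) kn Bk[OF gB] orthonormalD[OF B(1) gB gB] g_eq that
      by cases (auto simp: m_def)
  qed
  ultimately have "null_frame scale \<eta> N m"
    unfolding null_frame_def image using ind span by auto
  then show ?thesis by (auto simp: m_def)
qed

section \<open>Null eigenvectors of a bivector\<close>

text \<open>Let \<open>A y\<close> have coordinate \<open>K b y\<close> along each vector
  \<open>b\<close> of an orthonormal basis. The identity then holds for basis vectors
  \<open>x\<close> and extends by linearity in \<open>x\<close>.\<close>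

lemma ex_representing_operator:
  assumes K: "bilinear_form scale K"
  shows "\<exists>A. Vector_Spaces.linear scale scale A \<and> (\<forall>x y. K x y = \<eta> x (A y))"
proof -
  obtain B where B: "orthonormal B" "span B = UNIV"
    using ex_orthonormal_basis[of UNIV] nondegenerate by auto
  note fin = finite_orthonormal[OF B(1)]
  define A where "A y = (\<Sum>b\<in>B. scale (K b y) b)" for y
  have Kr: "K x (y + z) = K x y + K x z" "K x (scale c y) = c * K x y"
    and Kl: "K (y + z) x = K y x + K z x" "K (scale c y) x = c * K y x" for x y z c
    using K by (auto simp: bilinear_form_def Vector_Spaces.linear_iff)
  have Kl0: "K 0 y = 0" for y using Kl(2)[of 0 0 y] by simp
  have A: "Vector_Spaces.linear scale scale A"
    by (auto simp: Vector_Spaces.linear_iff vector_space_axioms A_def Kr scale_left_distrib sum.distrib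
        scale_sum_right)
  have "K x y = \<eta> x (A y)" for x y
  proof -
    have "x \<in> span B" using B(2) by simp
    then show ?thesis
    proof (induction rule: span_induct_alt)
      case base
      show ?case by (simp add: Kl0 form_simps)
    next
      case (step c b x)
      have "\<eta> b (A y) = (\<Sum>b'\<in>B. if b' = b then K b' y else 0)"
        unfolding A_def form_simps
        by (intro sum.cong) (use orthonormalD[OF B(1)] step.hyps in auto)
      also have "\<dots> = K b y" using step.hyps fin by simp
      finally show ?case using step by (simp add: Kl form_simps)
    qed
  qed
  with A show ?thesis by blast
qed

text \<open>The eigenvector equation of \<open>A\<close> is stated through its products with all
  \<open>y\<close>: this makes \<open>K k y\<close> vanish whenever \<open>y\<close> is orthogonal
  to \<open>k\<close>, which is what alignment asks.\<close>

lemma ex_null_eigenvector: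
  assumes K: "bivector scale K" and dim: "dim UNIV \<ge> 2"
  shows "\<exists>k \<mu>. k \<noteq> 0 \<and> \<eta> k k = 0 \<and> (\<forall>y. K k y = \<mu> * \<eta> k y)"
proof -
  have skew: "K x y = - K y x" for x y using K unfolding bivector_def by blast
  obtain A where A: "Vector_Spaces.linear scale scale A" "\<And>x y. K x y = \<eta> x (A y)"
    using ex_representing_operator K unfolding bivector_def by blast
  have null: ?thesis if "k \<noteq> 0" "\<eta> k k = 0" "A k = scale c k" for k c
  proof -
    \<comment> \<open>\<open>A\<close> represents \<open>K\<close> in the second argument, so moving
      \<open>k\<close> there by skewness flips the sign of the eigenvalue.\<close>
    have "K k y = - c * \<eta> k y" for y
      using skew[of k y] that(3) by (simp add: A(2)[of y] form_simps form_commute[of k])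
    with that show ?thesis by blast
  qed
  \<comment> \<open>Skewness gives \<open>0 = K v v = c * \<eta> v v\<close>, so
    \<open>c = 0\<close>.\<close>
  have kernel: "A v = 0" if "A v = scale c v" "\<eta> v v \<noteq> 0" for v c
    using that skew[of v v] by (auto simp: A(2) form_simps)
  have "\<exists>x::'v. x \<noteq> 0"
    using dim dim_eq_0[of UNIV] by auto
  then obtain c v where v: "v \<noteq> 0" "A v = scale c v"
    using ex_eigenvector[OF A(1), of UNIV] by fastforce
  show ?thesis
  proof (cases "\<eta> v v = 0")
    case True
    then show ?thesis using null v by blast
  next
    case False
    then have Av: "A v = 0" using kernel v by blast
    let ?U = "{x. \<eta> v x = 0}"
    have "A ` ?U \<subseteq> ?U"
    proof safe
      fix x
      show "\<eta> v (A x) = 0" using skew[of v x] by (simp add: A(2) Av form_simps)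
    qed
    \<comment> \<open>Otherwise \<open>v\<close> alone would span the space, whose dimension is at
      least 2.\<close>
    moreover have "\<exists>x\<in>?U. x \<noteq> 0"
    proof (rule ccontr)
      assume *: "\<not> ?thesis"
      have "x \<in> span {v}" for x
      proof -
        have "x - scale (\<eta> v x / \<eta> v v) v \<in> ?U" using False by (simp add: form_simps)
        with * have "x = scale (\<eta> v x / \<eta> v v) v" by (metis eq_iff_diff_eq_0)
        then show ?thesis by (metis insertI1 span_base span_scale)
      qed
      then have "dim UNIV \<le> card {v}" by (intro dim_le_card) auto
      with dim show False by simp
    qed
    ultimately obtain d u where u: "\<eta> v u = 0" "u \<noteq> 0" "A u = scale d u"
      using ex_eigenvector[OF A(1) subspace_orthogonal] by blast
    show ?thesis
    proof (cases "\<eta> u u = 0")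
      case True
      then show ?thesis using null u by blast
    next
      case nz: False
      then have Au: "A u = 0" using kernel u by blast
      \<comment> \<open>\<open>a\<close> solves \<open>\<eta> u u + a^2 * \<eta> v v = 0\<close>,
        which makes \<open>u + a v\<close> null because \<open>u\<close> and \<open>v\<close> are
        orthogonal.\<close>
      define a where "a = csqrt (- \<eta> u u / \<eta> v v)"
      have a: "a * a = - \<eta> u u / \<eta> v v"
        unfolding a_def by (metis power2_csqrt power2_eq_square)
      define w where "w = u + scale a v"
      have "\<eta> w w = \<eta> u u + (a * a) * \<eta> v v"
        using u(1) by (simp add: w_def form_simps form_commute[of u v])
      also have "\<dots> = 0" using False by (simp add: a)
      finally have "\<eta> w w = 0" .
      \<comment> \<open>The non-zero product with \<open>u\<close> certifies that \<open>w\<close>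
        is not the zero vector.\<close>
      moreover have "\<eta> u w = \<eta> u u"
        using u(1) by (simp add: w_def form_simps form_commute[of u v])
      then have "w \<noteq> 0" using nz by (auto simp: form_simps)
      moreover have "A w = scale 0 w"
        using A(1) Au Av by (simp add: w_def Vector_Spaces.linear_iff)
      ultimately show ?thesis using null by blast
    qed
  qed
qed

text \<open>In a null frame, \<open>m j - z j * n\<close> is the space-like vector obtained by the
  null rotation about \<open>n\<close> that carries \<open>l\<close> to the finite point, so the
  polynomial is the rotated component \<open>K_0j\<close>.\<close>

lemma alignment_poly_eq_at_finite_point:
  assumes K: "bivector scale K"
  shows "alignment_poly N K m j z =
    K (finite_point scale N m z) (m j - scale (z j) (m 1))"
proof -
  interpret l: Vector_Spaces.linear scale "(*)" "\<lambda>x. K x y" for y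
    using K unfolding bivector_def bilinear_form_def by blast
  interpret r: Vector_Spaces.linear scale "(*)" "K x" for x
    using K unfolding bivector_def bilinear_form_def by blast
  \<comment> \<open>This removes the term from the \<open>n\<close>-part of the finite point paired
    with \<open>n\<close>, which has no counterpart in \<open>alignment_poly\<close>.\<close>
  have "K (m 1) (m 1) = - K (m 1) (m 1)"
    using K unfolding bivector_def by blast
  then have "K (m 1) (m 1) = 0" by simp
  let ?f = "finite_point scale N m z"
  have expand: "K ?f y = K (m 0) y + (\<Sum>i\<in>{2..<N}. z i * K (m i) y)
      - 1/2 * (\<Sum>i\<in>{2..<N}. z i * z i) * K (m 1) y" for y
    by (simp only: finite_point_def l.add l.diff l.sum l.scale)
  have "(\<Sum>i\<in>{2..<N}. z i * z j * K (m i) (m 1)) =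
      z j * (\<Sum>i\<in>{2..<N}. z i * K (m i) (m 1))"
    unfolding sum_distrib_left
    by (intro sum.cong refl) (simp only: mult.assoc mult.left_commute)
  then have "alignment_poly N K m j z = K ?f (m j) - z j * K ?f (m 1)"
    unfolding alignment_poly_def expand \<open>K (m 1) (m 1) = 0\<close> by (simp add: distrib_left)
  also have "\<dots> = K ?f (m j - scale (z j) (m 1))"
    by (simp only: r.diff r.scale)
  finally show ?thesis .
qed

end

theorem proposition4p3:
  fixes scale :: "complex \<Rightarrow> 'v::ab_group_add \<Rightarrow> 'v"
    and \<eta> K :: "'v \<Rightarrow> 'v \<Rightarrow> complex"
    and N :: nat
  assumes "vector_space scale"
    and "N \<ge> 2"
    and "vector_space.dim scale (UNIV :: 'v set) = N"
    and "nondegenerate_symmetric_form scale \<eta>"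
    and "bivector scale K"
  shows "\<exists>k. k \<noteq> 0 \<and> null_vector \<eta> k \<and>
           aligned scale \<eta> N K (direction scale k) \<and>
           (\<forall>m. null_frame scale \<eta> N m \<longrightarrow>
              alignment_zero scale \<eta> N K m (direction scale k))"
proof -
  interpret vector_space scale by fact
  obtain Basis where Basis: "independent Basis" "span Basis = UNIV" "card Basis = N"
    using basis_exists[of UNIV] assms(3) by (metis top.extremum_uniqueI)
  \<comment> \<open>Infinite sets have cardinality 0, so \<open>card Basis = N\<close> with
    \<open>N\<close> at least 2 makes \<open>Basis\<close> finite.\<close>
  interpret complex_quadratic_space scale Basis \<eta>
    by unfold_locales (use Basis assms in \<open>auto intro: card_ge_0_finite\<close>)
  obtain k \<mu> where k: "k \<noteq> 0" "\<eta> k k = 0" "\<And>y. K k y = \<mu> * \<eta> k y"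
    using ex_null_eigenvector[OF assms(5)] assms(2,3) by blast
  have extended: "direction scale k \<in> extended_space scale \<eta>"
    using k by (auto simp: extended_space_def null_vector_def)
  obtain m where m: "null_frame scale \<eta> N m" "m 0 = k"
    using ex_null_frame[OF k(1,2) assms(3)] by blast
  have aligned: "aligned scale \<eta> N K (direction scale k)"
    unfolding aligned_def
  proof (intro conjI extended exI[of _ m] ballI)
    show "m 0 \<in> direction scale k"
      unfolding direction_def m(2) by (simp add: span_base)
    show "K (m 0) (m i) = 0" if "i \<in> {2..<N}" for i
    proof -
      have "\<eta> (m 0) (m i) = 0"
        using m(1) that assms(2) unfolding null_frame_def by simp
      then show ?thesis using k(3) m(2) by simp
    qed
  qed (fact m(1))
  have "alignment_zero scale \<eta> N K m (direction scale k)" if m: "null_frame scale \<eta> N m" for m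
  proof -
    \<comment> \<open>Only a finite point calls for a computation; at infinity, being a zero is the
      alignment already shown.\<close>
    have "alignment_poly N K m j z = 0"
      if D: "direction scale k = direction scale (finite_point scale N m z)" and j: "j \<in> {2..<N}"
      for z j
    proof -
      let ?f = "finite_point scale N m z"
      have \<eta>m: "\<eta> (m a) (m b) =
          (if a = 0 \<and> b = 1 \<or> a = 1 \<and> b = 0 \<or> 2 \<le> a \<and> a = b then 1 else 0)"
        if "a < N" "b < N" for a b
        using m that unfolding null_frame_def by blast
      have "?f \<in> span {k}"
        using D unfolding direction_def by (metis insertI1 span_base)
      then obtain c where c: "?f = scale c k" by (auto simp: span_singleton)
      have "K ?f y = c * K k y" for y
        using assms(5) unfolding c bivector_def bilinear_form_def Vector_Spaces.linear_iff by blast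
      \<comment> \<open>The finite point is a multiple of \<open>k\<close> and inherits its
        eigenvector equation.\<close>
      then have eig: "K ?f y = \<mu> * \<eta> ?f y" for y
        by (simp add: c k(3) form_simps)
      have "(\<Sum>i\<in>{2..<N}. z i * \<eta> (m i) (m j)) = (\<Sum>i\<in>{2..<N}. if i = j then z i else 0)"
        using j by (intro sum.cong) (auto simp: \<eta>m)
      also have "\<dots> = z j" using j by simp
      \<comment> \<open>With \<open>\<eta> ?f (m 1) = 1\<close>, this makes
        \<open>m j - z j * m 1\<close> orthogonal to the finite point, so the eigenvector equation
        gives zero.\<close>
      finally have "\<eta> ?f (m j) = z j"
        using j by (simp add: finite_point_def form_simps \<eta>m)
      moreover have "\<eta> ?f (m 1) = 1"
        using assms(2) by (simp add: finite_point_def form_simps \<eta>m)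
      ultimately show ?thesis
        by (simp add: alignment_poly_eq_at_finite_point[OF assms(5)] eig form_simps)
    qed
    then show ?thesis
      unfolding alignment_zero_def using extended aligned by blast
  qed
  then show ?thesis
    using k aligned by (auto simp: null_vector_def)
qed

end
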